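(* Let $d\ge 1$ and $k\ge 2$ be integers, let $m>2$ be an integer, and put $r=\binom{k+d}{d}-1$. Suppose $F \in \mathbb{Z}_m[X_1,\dots, X_d ]$ has degree $k$ and $g_F=1$, and suppose $\Omega \subset [0,1]^{d}$ is well-shaped with $\mu(\Omega)\geq m^{-1}$. Then $$N_F(\Omega)\leq m^{d-\frac{k}{2r(k+1)}+o(1)}\mu(\Omega)^{1-\frac{k}{2r(k+1)}}+m^{d-\frac{1}{2r(k+1)}+o(1)}\mu(\Omega)$$ as $m \rightarrow \infty$.
   Context: $\mathbb{Z}_m=\mathbb{Z}/m\mathbb{Z}$. $\mu$ is Lebesgue measure on $[0,1]^d$, $\|\cdot\|$ is the Euclidean norm, and $\mathrm{dist}(\mathbf{x},\Omega)=\inf_{\mathbf{y}\in\Omega}\|\mathbf{x}-\mathbf{y}\|$ for $\mathbf{x}\in[0,1]^d$, $\Omega\subseteq[0,1]^d$. For $\Omega\subseteq[0,1]^d$, $N_F(\Omega)$ denotes the number of $\mathbf{x}=(x_1,\dots,x_d)\in\mathbb{Z}^d$ with $F(\mathbf{x})\equiv 0 \pmod m$ and $\left(\frac{x_1}{m},\dots,\frac{x_d}{m}\right)\in\Omega$. A set $\Omega\subseteq[0,1]^d$ is well-shaped if there exists a constant $C=C(\Omega)$ such that for every $\varepsilon>0$ the measures of the sets $$\Omega_\varepsilon^{+} = \{ \mathbf{u} \in [0,1]^d \setminus \Omega : \mathrm{dist}(\mathbf{u},\Omega) < \varepsilon \},\qquad \Omega_\varepsilon^{-} = \{ \mathbf{u}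 \in \Omega : \mathrm{dist}(\mathbf{u},[0,1]^d \setminus \Omega ) < \varepsilon \}$$ exist and satisfy $\mu(\Omega_\varepsilon^{\pm})\le C\varepsilon$. For a $d$-tuple of non-negative integers $\mathbf{i}=(i_1,\dots,i_d)$ write $\mathbf{x}^{\mathbf{i}}=x_1^{i_1}\cdots x_d^{i_d}$ and $|\mathbf{i}|=i_1+\dots+i_d$. For $F=\sum_{0\le|\mathbf{i}|\le k}\beta_{\mathbf{i}}\mathbf{x}^{\mathbf{i}}$ of degree $k$ define $$g_F=\min_{|\mathbf{i}|=k}\gcd(m,\beta_{\mathbf{i}}).$$ Thus $g_F=1$ means that some coefficient of a monomial of total degree $k$ is coprime to $m$. Convention on $o(1)$: each occurrence (possibly different at each occurrence) denotes a real quantity which is arbitrarily small in absolute value once the indicated parameter (here $m$) is large enough in terms of $d$, $k$ and the constant $C$ in the definition of well-shaped. That is, for every $\varepsilon>0$ there is $m_0=m_0(d,k,C,\varepsilon)$ such that for $m\ge m_0$ the inequality holds with the occurrences of $o(1)$ replaced by some real numbers in $[-\varepsilon,\varepsilon]$. *)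

theory Defs
  imports "HOL-Analysis.Analysis" "HOL-Library.Poly_Mapping" "HOL-Number_Theory.Cong"
begin

text \<open>The dimension $d \ge 1$ is \<open>CARD('d)\<close>. Multi-indices are vectors in \<open>nat ^ 'd\<close>.\<close>

type_synonym 'd mpoly = "(nat ^ 'd) \<Rightarrow>\<^sub>0 int"

definition multi_degree :: "nat ^ 'd \<Rightarrow> nat" where
  "multi_degree i = (\<Sum>j\<in>UNIV. i $ j)"

definition monomial_value :: "int ^ 'd \<Rightarrow> nat ^ 'd \<Rightarrow> int" where
  "monomial_value x i = (\<Prod>j\<in>UNIV. (x $ j) ^ (i $ j))"

text \<open>The elements of $\mathbb{Z}_m[X_1,\dots,X_d]$, each residue class in $\mathbb{Z}_m$ being
  represented by its canonical representative in $\{0,\dots,m-1\}$.\<close>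

definition polys_mod :: "nat \<Rightarrow> ('d::finite) mpoly set" where
  "polys_mod m = {F. \<forall>i. Poly_Mapping.lookup F i \<in> {0..<int m}}"

definition eval_mpoly :: "('d::finite) mpoly \<Rightarrow> int ^ 'd \<Rightarrow> int" where
  "eval_mpoly F x = (\<Sum>i\<in>Poly_Mapping.keys F. Poly_Mapping.lookup F i * monomial_value x i)"

text \<open>Total degree; for members of \<^const>\<open>polys_mod\<close> a coefficient is nonzero as an integer iff it
  is nonzero modulo $m$, so this is the degree over $\mathbb{Z}_m$. The zero polynomial gets
  degree 0.\<close>

definition total_degree :: "('d::finite) mpoly \<Rightarrow> nat" where
  "total_degree F = Max (insert 0 (multi_degree ` Poly_Mapping.keys F))"

text \<open>The minimum is over all multi-indices of degree \<open>total_degree F\<close>, including those with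
  vanishing coefficient, which contribute $\gcd(m,0) = m$.\<close>

definition g_coeff :: "nat \<Rightarrow> ('d::finite) mpoly \<Rightarrow> int" where
  "g_coeff m F =
     Min ((\<lambda>i. gcd (int m) (Poly_Mapping.lookup F i)) ` {i. multi_degree i = total_degree F})"

definition N_sol :: "nat \<Rightarrow> ('d::finite) mpoly \<Rightarrow> (real ^ 'd) set \<Rightarrow> nat" where
  "N_sol m F \<Omega> =
     card {x :: int ^ 'd. [eval_mpoly F x = 0] (mod int m) \<and>
                          (\<chi> j. real_of_int (x $ j) / real m) \<in> \<Omega>}"

abbreviation unit_cube :: "(real ^ 'd) set" where
  "unit_cube \<equiv> cbox 0 1"

text \<open>Extended-real valued so that the distance to the empty set is \<open>\<infinity>\<close>; the library's
  \<^const>\<open>infdist\<close> gives 0 there, which would make the full cube fail to be well-shaped.\<close>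

definition set_dist :: "real ^ 'd \<Rightarrow> (real ^ 'd) set \<Rightarrow> ereal" where
  "set_dist x \<Omega> = (INF y\<in>\<Omega>. ereal (norm (x - y)))"

definition outer_collar :: "(real ^ 'd) set \<Rightarrow> real \<Rightarrow> (real ^ 'd) set" where
  "outer_collar \<Omega> \<epsilon> = {u \<in> unit_cube - \<Omega>. set_dist u \<Omega> < ereal \<epsilon>}"

definition inner_collar :: "(real ^ 'd) set \<Rightarrow> real \<Rightarrow> (real ^ 'd) set" where
  "inner_collar \<Omega> \<epsilon> = {u \<in> \<Omega>. set_dist u (unit_cube - \<Omega>) < ereal \<epsilon>}"

text \<open>\<open>\<Omega>\<close> is well-shaped with constant \<open>C\<close>. Measurability of \<open>\<Omega>\<close> itself is not
  required separately: it follows, since the boundary of \<open>\<Omega>\<close> relative to the cube is null.\<close>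

definition well_shaped :: "real \<Rightarrow> (real ^ 'd) set \<Rightarrow> bool" where
  "well_shaped C \<Omega> \<longleftrightarrow> \<Omega> \<subseteq> unit_cube \<and>
     (\<forall>\<epsilon>>0. outer_collar \<Omega> \<epsilon> \<in> lmeasurable \<and> measure lebesgue (outer_collar \<Omega> \<epsilon>) \<le> C * \<epsilon> \<and>
            inner_collar \<Omega> \<epsilon> \<in> lmeasurable \<and> measure lebesgue (inner_collar \<Omega> \<epsilon>) \<le> C * \<epsilon>)"

end

theory Submission imports Defs "HOL-Computational_Algebra.Polynomial" begin

text \<open>
  Let \<open>i\<close> be a multi-index of degree \<open>k\<close> whose coefficient is coprime to \<open>m\<close>. If all points of a
  grid \<open>\<Prod>j A j\<close> with \<open>card (A j) = i $ j + 1\<close> are zeros of \<open>F\<close> modulo \<open>m\<close>, then the coefficient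
  formula behind the combinatorial Nullstellensatz shows that \<open>m\<close> divides a nonzero product of
  differences of coordinates. Hence a cube of side less than \<open>m powr (1 / E)\<close>, where
  \<open>E = (\<Sum>j. i $ j * (i $ j + 1))\<close>, contains no such grid of zeros. The box theorem of Erdos (an
  iteration of the Kovari-Sos-Turan count) then bounds the zeros in a cube with \<open>n\<close> points per side by a
  constant times \<open>n powr (d - 1 / Q)\<close>, where \<open>Q\<close> is the product of the \<open>i $ j + 1\<close> with the largest
  factor omitted. Covering \<open>\<Omega>\<close> by cubes of side about \<open>min (m * \<mu> \<Omega>) (m powr (1 / E))\<close>, whose number
  is controlled by the collar condition, gives the theorem. The exponents suffice since
  \<open>E * Q \<le> k * (\<Prod>j. i $ j + 1) \<le> k * (r + 1) \<le> 2 * r * (k + 1)\<close>, so that no mean value theorem of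
  Vinogradov type is needed.
\<close>

section \<open>Sets without large grids\<close>

text \<open>Double counting of pairs of a \<open>w\<close> and an \<open>l\<close>-subset
  \<open>B\<close> of \<open>X\<close> all of whose elements are related to \<open>w\<close>.
  Convexity gives at least \<open>card W * (t / l) ^ l\<close> pairs with
  \<open>t = \<rho> * n / 2\<close>, while there are at most \<open>n ^ l\<close> sets
  \<open>B\<close>, so an average \<open>B\<close> suffices.\<close>

lemma kst_step:
  fixes R :: "'w \<Rightarrow> 'b \<Rightarrow> bool" and \<rho> :: real
  assumes fW: "finite W" and fX: "finite X" and \<rho>: "0 < \<rho>" "\<rho> \<le> 1" and l: "l \<ge> 1"
    and dense: "\<rho> * real (card W) * real (card X) \<le> (\<Sum>w\<in>W. real (card {x\<in>X. R w x}))"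
    and large: "2 * real l \<le> \<rho> * real (card X)"
  shows "\<exists>B\<subseteq>X. card B = l \<and> (\<rho> / (2 * real l)) ^ l * real (card W) \<le> real (card {w\<in>W. \<forall>b\<in>B. R w b})"
proof (rule ccontr)
  assume neg: "\<not> ?thesis"
  define n where "n = card X"
  define d where "d w = card {x\<in>X. R w x}" for w
  \<comment> \<open>Degrees below \<open>l\<close> are cut to 0, because
    \<open>(d w / l) ^ l\<close> bounds \<open>d w choose l\<close> from below in general only for
    \<open>l \<le> d w\<close>. The cut loses at most \<open>l\<close> per \<open>w\<close>, which
    by \<open>large\<close> is at most half of \<open>\<rho> * n\<close>.\<close>
  define e where "e w = (if l \<le> d w then real (d w) else 0)" for w
  define t where "t = \<rho> * real n / 2"
  define q where "q = (\<rho> / (2 * real l)) ^ l * real (card W)"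
  define \<B> where "\<B> = {B. B \<subseteq> X \<and> card B = l}"
  have n: "2 * real l \<le> \<rho> * real n" using large by (simp add: n_def)
  have "\<rho> * real n \<le> real n" using \<rho> by (simp add: mult_left_le_one_le)
  hence ln: "l \<le> n" using n by linarith
  have t0: "t > 0" "real l \<le> t" using n l by (auto simp: t_def)
  have fB: "finite \<B>" unfolding \<B>_def using fX by simp
  have cB: "card \<B> = n choose l" unfolding \<B>_def n_def using n_subsets[OF fX] by simp
  have B0: "card \<B> > 0" using ln cB by (simp add: zero_less_binomial)
  have sum_e: "real (card W) * t \<le> sum e W"
  proof -
    have "real (d w) - real l \<le> e w" for w by (simp add: e_def)
    hence "(\<Sum>w\<in>W. real (d w) - real l) \<le> sum e W" by (intro sum_mono) auto
    moreover have "(\<Sum>w\<in>W. real (d w) - real l) = (\<Sum>w\<in>W. real (d w)) - real (card W) * real l"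
      by (simp add: sum_subtractf)
    moreover have "\<rho> * real (card W) * real n \<le> (\<Sum>w\<in>W. real (d w))"
      using dense by (simp add: n_def d_def)
    moreover have "real (card W) * real l \<le> real (card W) * t"
      using t0 by (intro mult_left_mono) auto
    ultimately show ?thesis by (simp add: t_def algebra_simps)
  qed
  \<comment> \<open>Bernoulli's inequality is the tangent line bound replacing Jensen's inequality for the power.\<close>
  have bern: "1 + real l * (e w / t - 1) \<le> (e w / t) ^ l" for w
  proof -
    have "e w / t \<ge> 0" using t0 by (simp add: e_def)
    thus ?thesis using Bernoulli_inequality[of "e w / t - 1" l] by simp
  qed
  have "real (card W) \<le> (\<Sum>w\<in>W. 1 + real l * (e w / t - 1))"
  proof -
    have "(\<Sum>w\<in>W. 1 + real l * (e w / t - 1)) = real (card W) + real l * (sum e W / t - real (card W))"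
      by (simp add: sum.distrib sum_distrib_left[symmetric] sum_subtractf sum_divide_distrib[symmetric])
    moreover have "real (card W) \<le> sum e W / t" using sum_e t0 by (simp add: field_simps)
    ultimately show ?thesis by simp
  qed
  also have "\<dots> \<le> (\<Sum>w\<in>W. (e w / t) ^ l)" by (intro sum_mono bern)
  finally have "real (card W) * t ^ l \<le> (\<Sum>w\<in>W. (e w) ^ l)"
    using t0 by (simp add: power_divide sum_divide_distrib[symmetric] field_simps)
  hence "real (card W) * (t / l) ^ l \<le> (\<Sum>w\<in>W. (e w / l) ^ l)"
    using l by (simp add: power_divide sum_divide_distrib[symmetric] divide_right_mono)
  also have "\<dots> \<le> (\<Sum>w\<in>W. real (d w choose l))"
  proof (intro sum_mono)
    fix w
    show "(e w / l) ^ l \<le> real (d w choose l)"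
      using binomial_ge_n_over_k_pow_k[of l "d w", where ?'a=real] l
      by (auto simp: e_def zero_power)
  qed
  also have "\<dots> = real (\<Sum>w\<in>W. card {B\<in>\<B>. \<forall>b\<in>B. R w b})"
  proof -
    have "d w choose l = card {B\<in>\<B>. \<forall>b\<in>B. R w b}" for w
    proof -
      have "{B\<in>\<B>. \<forall>b\<in>B. R w b} = {B. B \<subseteq> {x\<in>X. R w x} \<and> card B = l}"
        by (auto simp: \<B>_def)
      thus ?thesis using n_subsets[of "{x\<in>X. R w x}" l] fX by (simp add: d_def)
    qed
    thus ?thesis by simp
  qed
  also have "(\<Sum>w\<in>W. card {B\<in>\<B>. \<forall>b\<in>B. R w b}) = (\<Sum>B\<in>\<B>. card {w\<in>W. \<forall>b\<in>B. R w b})"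
    using fW fB by (intro sum_multicount_gen) auto
  also have "real \<dots> = (\<Sum>B\<in>\<B>. real (card {w\<in>W. \<forall>b\<in>B. R w b}))" by simp
  also have "\<dots> < (\<Sum>B\<in>\<B>. q)"
  proof (rule sum_strict_mono)
    show "finite \<B>" "\<B> \<noteq> {}" using fB B0 by auto
    fix B assume "B \<in> \<B>"
    thus "real (card {w\<in>W. \<forall>b\<in>B. R w b}) < q"
      using neg unfolding q_def \<B>_def by (metis (mono_tags, lifting) mem_Collect_eq not_le)
  qed
  also have "\<dots> = real (n choose l) * q" using cB by simp
  also have "\<dots> \<le> real n ^ l * q"
    using \<rho> by (intro mult_right_mono)
      (metis binomial_le_pow binomial_eq_0 ln of_nat_le_iff of_nat_power, simp add: q_def)
  also have "\<dots> = real (card W) * (t / l) ^ l"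
    by (simp add: q_def t_def power_divide power_mult_distrib)
  finally show False by simp
qed

text \<open>Coordinates are fixed one at a time. With the pairs of a \<open>y\<close> and a choice
  of the other coordinates as \<open>W\<close>, \<open>kst_step\<close> finds \<open>l j\<close>
  values common to a dense set of pairs, and the induction hypothesis treats that set. Each step
  raises the density to the power \<open>l j\<close>, hence the product in the exponent. The factor
  \<open>Y\<close> passes through all steps and is only counted at the end.\<close>

lemma box_iterate:
  fixes l :: "'i \<Rightarrow> nat"
  assumes "finite J" "\<And>j. l j \<ge> 1"
  shows "\<exists>c K. 0 < c \<and> 0 < K \<and> (\<forall>(\<rho>::real) n (X :: 'i \<Rightarrow> 'b set) (Y :: 'y set) S.
     0 < \<rho> \<longrightarrow> \<rho> \<le> 1 \<longrightarrow> finite Y \<longrightarrow> (\<forall>j\<in>J. finite (X j) \<and> card (X j) = n) \<longrightarrow>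
     S \<subseteq> Y \<times> PiE J X \<longrightarrow> \<rho> * real (card Y) * real n ^ card J \<le> real (card S) \<longrightarrow>
     K \<le> \<rho> ^ (\<Prod>j\<in>J. l j) * real n \<longrightarrow>
     (\<exists>B. (\<forall>j\<in>J. B j \<subseteq> X j \<and> card (B j) = l j) \<and>
       c * \<rho> ^ (\<Prod>j\<in>J. l j) * real (card Y) \<le> real (card {y\<in>Y. {y} \<times> PiE J B \<subseteq> S})))"
  using assms(1)
proof (induction J rule: finite_induct)
  case empty
  show ?case
  proof (rule exI[of _ 1], rule exI[of _ 1], simp, intro allI impI)
    fix \<rho> :: real and Y :: "'y set" and S :: "('y \<times> ('i \<Rightarrow> 'b)) set"
    assume *: "0 < \<rho>" "finite Y" "S \<subseteq> Y \<times> {\<lambda>x. undefined}" "\<rho> * real (card Y) \<le> real (card S)"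
    \<comment> \<open>With no coordinate left the only function is the undefined one, so
      \<open>S\<close> is a copy of a subset of \<open>Y\<close>.\<close>
    have "S = (\<lambda>y. (y, \<lambda>x. undefined)) ` {y \<in> Y. (y, \<lambda>x. undefined) \<in> S}" using *(3) by auto
    hence "card S = card {y \<in> Y. (y, \<lambda>x. undefined) \<in> S}"
      by (metis (no_types, lifting) card_image inj_onI prod.inject)
    thus "\<rho> * real (card Y) \<le> real (card {y \<in> Y. (y, \<lambda>x. undefined) \<in> S})" using * by simp
  qed
next
  case (insert j J)
  obtain c' K' where c': "0 < c'" "0 < K'" and IH: "\<forall>(\<rho>::real) n (X :: 'i \<Rightarrow> 'b set) (Y :: 'y set) S.
     0 < \<rho> \<longrightarrow> \<rho> \<le> 1 \<longrightarrow> finite Y \<longrightarrow> (\<forall>j\<in>J. finite (X j) \<and> card (X j) = n) \<longrightarrow>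
     S \<subseteq> Y \<times> PiE J X \<longrightarrow> \<rho> * real (card Y) * real n ^ card J \<le> real (card S) \<longrightarrow>
     K' \<le> \<rho> ^ (\<Prod>j\<in>J. l j) * real n \<longrightarrow>
     (\<exists>B. (\<forall>j\<in>J. B j \<subseteq> X j \<and> card (B j) = l j) \<and>
       c' * \<rho> ^ (\<Prod>j\<in>J. l j) * real (card Y) \<le> real (card {y\<in>Y. {y} \<times> PiE J B \<subseteq> S}))"
    using insert.IH by (elim exE conjE)
  define p where "p = (\<Prod>j\<in>J. l j)"
  define a where "a = (2 * real (l j)) ^ (l j * p)"
  have lj: "l j \<ge> 1" by (rule assms)
  have a0: "a > 0" using lj by (simp add: a_def)
  have p1: "p \<ge> 1" unfolding p_def using assms(2) by (meson prod_ge_1)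
  have pins: "(\<Prod>j\<in>insert j J. l j) = l j * p" using insert.hyps by (simp add: p_def)
  show ?case unfolding pins
  \<comment> \<open>\<open>a\<close> is the loss in
    \<open>\<rho>' ^ p = \<rho> ^ (l j * p) / a\<close>, so \<open>c'\<close> and \<open>K'\<close>
    are rescaled by it; \<open>2 * real (l j)\<close> in the maximum supplies the size condition of
    \<open>kst_step\<close>.\<close>
  proof (rule exI[of _ "c' / a"], rule exI[of _ "max (2 * real (l j)) (K' * a)"], intro conjI allI impI)
    show "0 < c' / a" using c' a0 by simp
    show "0 < max (2 * real (l j)) (K' * a)" using c' a0 by (simp add: less_max_iff_disj)
    fix \<rho> :: real and n and X :: "'i \<Rightarrow> 'b set" and Y :: "'y set" and S
    assume \<rho>: "0 < \<rho>" "\<rho> \<le> 1" and fY: "finite Y"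
      and X: "\<forall>i\<in>insert j J. finite (X i) \<and> card (X i) = n"
      and S: "S \<subseteq> Y \<times> PiE (insert j J) X"
      and dS: "\<rho> * real (card Y) * real n ^ card (insert j J) \<le> real (card S)"
      and K: "max (2 * real (l j)) (K' * a) \<le> \<rho> ^ (l j * p) * real n"
    define W where "W = Y \<times> PiE J X"
    \<comment> \<open>A partial point is related to the values of coordinate \<open>j\<close> that
      complete it to a point of \<open>S\<close>, so \<open>S\<close> becomes the edge set of a
      bipartite graph between \<open>W\<close> and \<open>X j\<close>.\<close>
    define R where "R = (\<lambda>(y, f) x. (y, f(j := x)) \<in> S)"
    define \<rho>' where "\<rho>' = (\<rho> / (2 * real (l j))) ^ l j"
    have fW: "finite W" unfolding W_def using fY X insert.hyps by (auto intro!: finite_PiE)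
    have cW: "card W = card Y * n ^ card J" unfolding W_def card_cartesian_product
      using X insert.hyps by (simp add: card_PiE)
    have cS: "card S = (\<Sum>w\<in>W. card {x\<in>X j. R w x})"
    proof -
      have "bij_betw (\<lambda>((y, f), x). (y, f(j := x))) (SIGMA w:W. {x\<in>X j. R w x}) S"
      proof (rule bij_betwI[where g = "\<lambda>(y, f). ((y, f(j := undefined)), f j)"])
        show "(\<lambda>((y, f), x). (y, f(j := x))) \<in> (SIGMA w:W. {x \<in> X j. R w x}) \<rightarrow> S"
          by (auto simp: R_def)
        show "(\<lambda>(y, f). ((y, f(j := undefined)), f j)) \<in> S \<rightarrow> (SIGMA w:W. {x \<in> X j. R w x})"
        proof (rule Pi_I)
          fix z assume "z \<in> S"
          then obtain y f where "z = (y, f)" "(y, f) \<in> S" "y \<in> Y" "f \<in> PiE (insert j J) X" using S by auto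
          thus "(case z of (y, f) \<Rightarrow> ((y, f(j := undefined)), f j)) \<in> (SIGMA w:W. {x \<in> X j. R w x})"
            using insert.hyps by (auto simp: R_def W_def PiE_def extensional_def Pi_def)
        qed
        show "(\<lambda>(y, f). ((y, f(j := undefined)), f j)) ((\<lambda>((y, f), x). (y, f(j := x))) z) = z"
          if "z \<in> (SIGMA w:W. {x \<in> X j. R w x})" for z
          using that insert.hyps by (auto simp: W_def PiE_def extensional_def fun_eq_iff)
        show "(\<lambda>((y, f), x). (y, f(j := x))) ((\<lambda>(y, f). ((y, f(j := undefined)), f j)) z) = z" for z
          by (cases z) simp
      qed
      hence "card S = card (SIGMA w:W. {x\<in>X j. R w x})" by (simp add: bij_betw_same_card)
      thus ?thesis using fW X by simp
    qed
    have "\<rho> ^ (l j * p) \<le> \<rho> ^ 1" using \<rho> lj p1 by (intro power_decreasing) auto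
    hence big: "2 * real (l j) \<le> \<rho> * real n" using K
      by (smt (verit) mult_right_mono of_nat_0_le_iff power_one_right)
    have "\<exists>Bj\<subseteq>X j. card Bj = l j \<and> (\<rho> / (2 * real (l j))) ^ l j * real (card W) \<le> real (card {w\<in>W. \<forall>b\<in>Bj. R w b})"
    proof (rule kst_step)
      show "\<rho> * real (card W) * real (card (X j)) \<le> (\<Sum>w\<in>W. real (card {x \<in> X j. R w x}))"
        using dS X insert.hyps by (simp add: cW cS algebra_simps)
    qed (use fW X \<rho> lj big in auto)
    then obtain Bj where Bj: "Bj \<subseteq> X j" "card Bj = l j"
      and dens: "\<rho>' * real (card W) \<le> real (card {w\<in>W. \<forall>b\<in>Bj. R w b})"
      unfolding \<rho>'_def by blast
    define T where "T = {w\<in>W. \<forall>b\<in>Bj. R w b}"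
    have \<rho>': "0 < \<rho>'" "\<rho>' \<le> 1" using \<rho> lj by (auto simp: \<rho>'_def intro!: power_le_one)
    have \<rho>p: "\<rho>' ^ p = \<rho> ^ (l j * p) / a"
      by (simp add: \<rho>'_def a_def power_mult power_divide)
    have "\<exists>B. (\<forall>j\<in>J. B j \<subseteq> X j \<and> card (B j) = l j) \<and>
       c' * \<rho>' ^ (\<Prod>j\<in>J. l j) * real (card Y) \<le> real (card {y\<in>Y. {y} \<times> PiE J B \<subseteq> T})"
    proof (rule IH[rule_format])
      show "finite (X j) \<and> card (X j) = n" if "j \<in> J" for j using X that by simp
      show "T \<subseteq> Y \<times> PiE J X" by (auto simp: T_def W_def)
      show "\<rho>' * real (card Y) * real n ^ card J \<le> real (card T)" using dens by (simp add: T_def cW algebra_simps)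
      show "K' \<le> \<rho>' ^ (\<Prod>j\<in>J. l j) * real n"
        using K a0 by (simp add: p_def[symmetric] \<rho>p field_simps)
    qed (use \<rho>' fY in auto)
    then obtain B where B: "\<forall>j\<in>J. B j \<subseteq> X j \<and> card (B j) = l j"
      and dB: "c' * \<rho>' ^ p * real (card Y) \<le> real (card {y\<in>Y. {y} \<times> PiE J B \<subseteq> T})"
      unfolding p_def by blast
    let ?B = "B(j := Bj)"
    \<comment> \<open>A point of the larger box is a point of \<open>PiE J B\<close> together with a
      value in \<open>Bj\<close>; membership of the former in \<open>T\<close> allows every such
      value.\<close>
    have "{y\<in>Y. {y} \<times> PiE J B \<subseteq> T} \<subseteq> {y\<in>Y. {y} \<times> PiE (insert j J) ?B \<subseteq> S}"
    proof safe
      fix y f assume y: "{y} \<times> PiE J B \<subseteq> T" and f: "f \<in> PiE (insert j J) ?B"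
      have "f(j := undefined) \<in> PiE J B"
        using f insert.hyps by (auto simp: PiE_def extensional_def Pi_def split: if_splits)
      hence "(y, f(j := undefined)) \<in> T" using y by auto
      moreover have "f j \<in> Bj" using PiE_mem[OF f, of j] by simp
      ultimately show "(y, f) \<in> S" by (fastforce simp: T_def R_def)
    qed
    hence "card {y\<in>Y. {y} \<times> PiE J B \<subseteq> T} \<le> card {y\<in>Y. {y} \<times> PiE (insert j J) ?B \<subseteq> S}"
      using fY by (intro card_mono) auto
    hence "c' / a * \<rho> ^ (l j * p) * real (card Y) \<le> real (card {y\<in>Y. {y} \<times> PiE (insert j J) ?B \<subseteq> S})"
      using dB by (simp add: \<rho>p)
    moreover have "\<forall>i\<in>insert j J. ?B i \<subseteq> X i \<and> card (?B i) = l i" using B Bj by auto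
    ultimately show "\<exists>B. (\<forall>i\<in>insert j J. B i \<subseteq> X i \<and> card (B i) = l i) \<and>
        c' / a * \<rho> ^ (l j * p) * real (card Y) \<le> real (card {y\<in>Y. {y} \<times> PiE (insert j J) B \<subseteq> S})"
      by blast
  qed
qed

text \<open>\<open>box_iterate\<close> runs over the coordinates other than \<open>j0\<close>, with
  \<open>X j0\<close> as \<open>Y\<close>. If the density were too large, some box would be shared
  by \<open>l j0\<close> values of coordinate \<open>j0\<close>, completing a forbidden grid. For
  that last coordinate a fixed number of values suffices instead of a positive proportion, which
  keeps \<open>l j0\<close> out of the exponent.\<close>

lemma box_free_bound:
  fixes l :: "'i::finite \<Rightarrow> nat" and j0 :: 'i
  assumes l: "\<And>j. l j \<ge> 1"
  shows "\<exists>K>0. \<forall>n (X :: 'i \<Rightarrow> 'b set) S. n \<ge> 1 \<longrightarrow> (\<forall>j. finite (X j) \<and> card (X j) = n) \<longrightarrow>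
     S \<subseteq> Pi UNIV X \<longrightarrow> \<not> (\<exists>B. (\<forall>j. B j \<subseteq> X j \<and> card (B j) = l j) \<and> Pi UNIV B \<subseteq> S) \<longrightarrow>
     real (card S) \<le> K * real n ^ CARD('i) * real n powr (- 1 / real (\<Prod>j\<in>-{j0}. l j))"
proof -
  define J where "J = - {j0}"
  define q where "q = (\<Prod>j\<in>J. l j)"
  have q1: "q \<ge> 1" unfolding q_def using l by (meson prod_ge_1)
  have UJ: "UNIV = insert j0 J" "j0 \<notin> J" by (auto simp: J_def)
  hence cJ: "CARD('i) = Suc (card J)"
    by (metis card_insert_disjoint finite)
  obtain c K where c: "0 < c" "0 < K" and main: "\<forall>(\<rho>::real) n (X :: 'i \<Rightarrow> 'b set) (Y :: 'b set) S.
     0 < \<rho> \<longrightarrow> \<rho> \<le> 1 \<longrightarrow> finite Y \<longrightarrow> (\<forall>j\<in>J. finite (X j) \<and> card (X j) = n) \<longrightarrow>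
     S \<subseteq> Y \<times> PiE J X \<longrightarrow> \<rho> * real (card Y) * real n ^ card J \<le> real (card S) \<longrightarrow>
     K \<le> \<rho> ^ q * real n \<longrightarrow>
     (\<exists>B. (\<forall>j\<in>J. B j \<subseteq> X j \<and> card (B j) = l j) \<and>
       c * \<rho> ^ q * real (card Y) \<le> real (card {y\<in>Y. {y} \<times> PiE J B \<subseteq> S}))"
    using box_iterate[of J l, OF finite l, where ?'b='b and ?'y='b] unfolding q_def by (elim exE conjE)
  \<comment> \<open>The first entry lets \<open>box_iterate\<close> apply, the second makes the
    number of common values at least \<open>l j0\<close>.\<close>
  define K0 where "K0 = max K (real (l j0) / c)"
  have K0: "K0 > 0" using c by (simp add: K0_def)
  show ?thesis
  proof (rule exI[of _ "K0 powr (1 / real q)"], intro conjI allI impI)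
    show "0 < K0 powr (1 / real q)" using K0 by simp
    fix n and X :: "'i \<Rightarrow> 'b set" and S
    assume n: "n \<ge> 1" and X: "\<forall>j. finite (X j) \<and> card (X j) = n" and S: "S \<subseteq> Pi UNIV X"
      and free: "\<not> (\<exists>B. (\<forall>j. B j \<subseteq> X j \<and> card (B j) = l j) \<and> Pi UNIV B \<subseteq> S)"
    define \<rho> where "\<rho> = real (card S) / real n ^ CARD('i)"
    have fPi: "finite (Pi UNIV X)" using X finite_PiE[of UNIV X] by (simp add: PiE_UNIV_domain)
    have "card S \<le> n ^ CARD('i)"
      using card_mono[OF fPi S] X card_PiE[of UNIV X] by (simp add: PiE_UNIV_domain)
    hence "real (card S) \<le> real n ^ CARD('i)" by (metis of_nat_le_iff of_nat_power)
    hence \<rho>1: "\<rho> \<le> 1" using n by (simp add: \<rho>_def)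
    have \<rho>0: "\<rho> \<ge> 0" by (simp add: \<rho>_def)
    have lt: "\<rho> ^ q * real n < K0"
    proof (rule ccontr)
      assume "\<not> \<rho> ^ q * real n < K0"
      hence big: "K \<le> \<rho> ^ q * real n" and "real (l j0) / c \<le> \<rho> ^ q * real n"
        by (auto simp: K0_def)
      hence big: "K \<le> \<rho> ^ q * real n" "real (l j0) \<le> c * (\<rho> ^ q * real n)"
        using c by (auto simp: pos_divide_le_eq mult.commute)
      have "\<rho> \<noteq> 0" using big c q1 by (auto simp: zero_power)
      hence \<rho>pos: "\<rho> > 0" using \<rho>0 by simp
      \<comment> \<open>The two-part form that \<open>box_iterate\<close> expects: setting
        coordinate \<open>j0\<close> to \<open>undefined\<close> makes the rest extensional on
        \<open>J\<close>.\<close>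
      define S' where "S' = (\<lambda>f. (f j0, f(j0 := undefined))) ` S"
      have inj: "inj_on (\<lambda>f. (f j0, f(j0 := undefined))) S"
        by (rule inj_onI) (metis fun_upd_triv fun_upd_upd prod.inject)
      have cS': "card S' = card S" unfolding S'_def by (rule card_image[OF inj])
      have "\<exists>B. (\<forall>j\<in>J. B j \<subseteq> X j \<and> card (B j) = l j) \<and>
        c * \<rho> ^ q * real (card (X j0)) \<le> real (card {y\<in>X j0. {y} \<times> PiE J B \<subseteq> S'})"
      proof (rule main[rule_format])
        show "S' \<subseteq> X j0 \<times> PiE J X" using S by (fastforce simp: S'_def J_def PiE_def extensional_def Pi_def)
        show "\<rho> * real (card (X j0)) * real n ^ card J \<le> real (card S')"
          using X n unfolding cS' \<rho>_def cJ by simp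
      qed (use X \<rho>pos \<rho>1 big in auto)
      then obtain B where B: "\<forall>j\<in>J. B j \<subseteq> X j \<and> card (B j) = l j"
        and "c * \<rho> ^ q * real (card (X j0)) \<le> real (card {y\<in>X j0. {y} \<times> PiE J B \<subseteq> S'})" by blast
      hence "l j0 \<le> card {y\<in>X j0. {y} \<times> PiE J B \<subseteq> S'}" using big X by (simp add: mult.assoc)
      then obtain D where D: "D \<subseteq> {y\<in>X j0. {y} \<times> PiE J B \<subseteq> S'}" "card D = l j0"
        by (meson obtain_subset_with_card_n)
      have "Pi UNIV (B(j0 := D)) \<subseteq> S"
      proof
        fix f assume f: "f \<in> Pi UNIV (B(j0 := D))"
        have "f(j0 := undefined) \<in> PiE J B"
          using f by (auto simp: J_def PiE_def extensional_def Pi_def split: if_splits)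
        moreover have "f j0 \<in> D" using f by (auto simp: Pi_def dest: spec[of _ j0])
        ultimately have "(f j0, f(j0 := undefined)) \<in> S'" using D(1) by auto
        then obtain g where "g \<in> S" "f j0 = g j0" "f(j0 := undefined) = g(j0 := undefined)"
          by (auto simp: S'_def)
        thus "f \<in> S" by (metis fun_upd_triv fun_upd_upd)
      qed
      moreover have "\<forall>j. (B(j0 := D)) j \<subseteq> X j \<and> card ((B(j0 := D)) j) = l j"
        using B D by (auto simp: J_def)
      ultimately show False using free by blast
    qed
    have "\<rho> \<le> (K0 / real n) powr (1 / real q)"
    proof (cases "\<rho> = 0")
      case False
      hence "\<rho> = (\<rho> ^ q) powr (1 / real q)" using \<rho>0 q1
        by (simp add: powr_realpow[symmetric] powr_powr)
      also have "\<dots> \<le> (K0 / real n) powr (1 / real q)"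
        using lt n \<rho>0 by (intro powr_mono2) (auto simp: field_simps)
      finally show ?thesis .
    qed auto
    also have "\<dots> = K0 powr (1 / real q) * real n powr (- 1 / real q)"
      using K0 n powr_divide[of K0 "real n" "1 / real q"] by (simp add: powr_minus_divide)
    finally show "real (card S) \<le> K0 powr (1 / real q) * real n ^ CARD('i) * real n powr (- 1 / real (\<Prod>j\<in>-{j0}. l j))"
      using n unfolding q_def[symmetric] J_def[symmetric] by (simp add: \<rho>_def field_simps)
  qed
qed

section \<open>Grids of zeros\<close>

definition diff_prod :: "int set \<Rightarrow> int" where
  "diff_prod A = (\<Prod>a\<in>A. \<Prod>b\<in>A-{a}. a - b)"

text \<open>\<open>diff_prod A\<close> is, up to sign, the square of the Vandermonde determinant of \<open>A\<close>. With it as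
  common denominator the Lagrange weights \<open>1 / (\<Prod>b\<in>A-{a}. a - b)\<close> become the integers
  \<open>cofactor A a\<close>.\<close>

definition cofactor :: "int set \<Rightarrow> int \<Rightarrow> int" where
  "cofactor A a = (\<Prod>a'\<in>A-{a}. \<Prod>b\<in>A-{a'}. a' - b)"

text \<open>This is the \<open>n\<close>-th divided difference of \<open>x ^ e\<close>. Lagrange
  interpolation at the \<open>n + 1\<close> nodes reproduces the monomial, and each interpolating
  product is monic of degree \<open>n\<close>, so comparing coefficients of degree \<open>n\<close>
  gives the sum.\<close>

lemma power_divided_difference:
  fixes A :: "'a::field set"
  assumes "finite A" "card A = Suc n" "e \<le> n"
  shows "(\<Sum>a\<in>A. a ^ e / (\<Prod>b\<in>A-{a}. a - b)) = (if e = n then 1 else 0)"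
proof -
  define L where "L a = smult (a ^ e / (\<Prod>b\<in>A-{a}. a - b)) (\<Prod>b\<in>A-{a}. [:-b, 1:])" for a
  have deg: "degree (\<Prod>b\<in>A-{a}. [:-b, 1:]) = n" if "a \<in> A" for a
    using assms that by (subst degree_prod_eq_sum_degree) auto
  have lead: "coeff (\<Prod>b\<in>A-{a}. [:-b, 1:]) n = 1" if "a \<in> A" for a
    using lead_coeff_prod[of "\<lambda>b. [:-b, 1:]" "A-{a}"] deg[OF that] by simp
  have degL: "degree (\<Sum>a\<in>A. L a) \<le> n"
    using deg by (intro degree_sum_le) (auto simp: L_def assms)
  have "(\<Sum>a\<in>A. L a) = monom 1 e"
  proof (rule poly_eqI_degree[where A = A])
    fix x assume x: "x \<in> A"
    have "poly (L a) x = (if a = x then x ^ e else 0)" if "a \<in> A" for a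
      using assms(1) x by (auto simp: L_def poly_prod)
    hence "poly (\<Sum>a\<in>A. L a) x = (\<Sum>a\<in>A. if a = x then x ^ e else 0)"
      by (simp add: poly_sum)
    also have "\<dots> = x ^ e" using x assms(1) by simp
    finally show "poly (\<Sum>a\<in>A. L a) x = poly (monom 1 e) x" by (simp add: poly_monom)
  next
    show "degree (\<Sum>a\<in>A. L a) < card A" "degree (monom 1 e :: 'a poly) < card A"
      using degL degree_monom_le[of "1::'a" e] assms by auto
  qed
  hence "coeff (\<Sum>a\<in>A. L a) n = (if e = n then 1 else 0)" by simp
  moreover have "coeff (\<Sum>a\<in>A. L a) n = (\<Sum>a\<in>A. a ^ e / (\<Prod>b\<in>A-{a}. a - b))"
    unfolding coeff_sum by (intro sum.cong) (simp_all add: L_def lead)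
  ultimately show ?thesis by simp
qed

text \<open>Multiplying the divided difference by \<open>diff_prod A\<close> clears its
  denominators; the division itself is carried out in the reals.\<close>

lemma cofactor_power_sum:
  assumes "finite A" "card A = Suc n" "e \<le> n"
  shows "(\<Sum>a\<in>A. cofactor A a * a ^ e) = (if e = n then diff_prod A else 0)"
proof -
  let ?R = "of_int :: int \<Rightarrow> real"
  let ?w = "\<lambda>a. \<Prod>b\<in>?R ` A - {?R a}. ?R a - b"
  have w: "?w a = ?R (\<Prod>b\<in>A-{a}. a - b)" if "a \<in> A" for a
  proof -
    have "?R ` A - {?R a} = ?R ` (A - {a})" by auto
    thus ?thesis by (simp add: prod.reindex inj_on_def)
  qed
  have *: "?R (cofactor A a) = ?R (diff_prod A) / ?w a" if "a \<in> A" for a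
  proof -
    have "diff_prod A = (\<Prod>b\<in>A-{a}. a - b) * cofactor A a"
      unfolding diff_prod_def cofactor_def using assms that by (simp add: prod.remove)
    moreover have "(\<Prod>b\<in>A-{a}. a - b) \<noteq> 0" using assms by simp
    ultimately show ?thesis unfolding w[OF that]
      by (metis nonzero_mult_div_cancel_left of_int_eq_0_iff of_int_mult)
  qed
  have "?R (\<Sum>a\<in>A. cofactor A a * a ^ e) = (\<Sum>a\<in>A. ?R (diff_prod A) * (?R a ^ e / ?w a))"
    by (simp add: * of_int_sum)
  also have "\<dots> = ?R (diff_prod A) * (\<Sum>x\<in>?R ` A. x ^ e / (\<Prod>b\<in>?R ` A - {x}. x - b))"
    by (simp add: sum_distrib_left sum.reindex inj_on_def)
  also have "\<dots> = ?R (if e = n then diff_prod A else 0)"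
    using assms by (subst power_divided_difference[where n = n]) (auto simp: card_image inj_on_def)
  finally show ?thesis by linarith
qed

lemma diff_prod_nonzero: "finite A \<Longrightarrow> diff_prod A \<noteq> 0"
  by (simp add: diff_prod_def)

lemma abs_diff_prod_le:
  assumes "finite A" "card A = Suc n" "\<And>a b. a \<in> A \<Longrightarrow> b \<in> A \<Longrightarrow> \<bar>a - b\<bar> \<le> M"
  shows "\<bar>diff_prod A\<bar> \<le> M ^ (n * Suc n)"
proof -
  have "(\<Prod>b\<in>A-{a}. \<bar>a - b\<bar>) \<le> M ^ n" if "a \<in> A" for a
  proof -
    have "(\<Prod>b\<in>A-{a}. \<bar>a - b\<bar>) \<le> (\<Prod>b\<in>A-{a}. M)"
      using assms(3) that by (intro prod_mono) auto
    thus ?thesis using assms that by simp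
  qed
  hence "(\<Prod>a\<in>A. \<Prod>b\<in>A-{a}. \<bar>a - b\<bar>) \<le> (\<Prod>a\<in>A. M ^ n)"
    by (intro prod_mono) (auto intro: prod_nonneg)
  thus ?thesis using assms(2) by (simp add: diff_prod_def abs_prod power_mult power_add mult.commute)
qed

text \<open>For a single monomial the weighted sum factors into one-variable sums. A monomial other
  than \<open>i\<close> of no larger degree has some exponent below that of \<open>i\<close>, and
  that factor vanishes by \<open>cofactor_power_sum\<close>, whatever the other factors are. So the
  sum isolates one coefficient.\<close>

lemma combinatorial_nullstellensatz_sum:
  fixes F :: "('d::finite) mpoly" and A :: "'d \<Rightarrow> int set"
  assumes deg: "\<And>e. e \<in> Poly_Mapping.keys F \<Longrightarrow> multi_degree e \<le> multi_degree i"
    and A: "\<And>j. finite (A j)" "\<And>j. card (A j) = Suc (i $ j)"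
  shows "(\<Sum>x\<in>PiE UNIV A. (\<Prod>j\<in>UNIV. cofactor (A j) (x j)) * eval_mpoly F (vec_lambda x)) =
    Poly_Mapping.lookup F i * (\<Prod>j\<in>UNIV. diff_prod (A j))"
proof -
  let ?w = "\<lambda>x. \<Prod>j\<in>UNIV. cofactor (A j) (x j)"
  let ?D = "\<Prod>j\<in>UNIV. diff_prod (A j)"
  have mono: "(\<Sum>x\<in>PiE UNIV A. ?w x * monomial_value (vec_lambda x) e) = (if e = i then ?D else 0)"
    if e: "e \<in> Poly_Mapping.keys F" for e
  proof -
    have "(\<Sum>x\<in>PiE UNIV A. ?w x * monomial_value (vec_lambda x) e)
        = (\<Sum>x\<in>PiE UNIV A. \<Prod>j\<in>UNIV. cofactor (A j) (x j) * x j ^ (e $ j))"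
      by (simp add: monomial_value_def prod.distrib)
    also have "\<dots> = (\<Prod>j\<in>UNIV. \<Sum>a\<in>A j. cofactor (A j) a * a ^ (e $ j))"
      using A by (subst prod_sum_PiE) auto
    also have "\<dots> = (if e = i then ?D else 0)"
    proof (cases "e = i")
      case True
      thus ?thesis using cofactor_power_sum A by simp
    next
      case False
      \<comment> \<open>Exponents dominating \<open>i\<close> everywhere without equality would have
        larger total degree.\<close>
      have "\<exists>j. e $ j < i $ j"
      proof (rule ccontr)
        assume "\<not> ?thesis"
        hence le: "\<And>j. i $ j \<le> e $ j" by (simp add: not_less)
        obtain j where "e $ j \<noteq> i $ j" using False by (auto simp: vec_eq_iff)
        hence "i $ j < e $ j" using le[of j] by simp
        hence "(\<Sum>j\<in>UNIV. i $ j) < (\<Sum>j\<in>UNIV. e $ j)" using le by (intro sum_strict_mono_ex1) auto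
        thus False using deg[OF e] by (simp add: multi_degree_def)
      qed
      then obtain j where "e $ j < i $ j" by blast
      hence "(\<Sum>a\<in>A j. cofactor (A j) a * a ^ (e $ j)) = 0"
        using cofactor_power_sum[OF A(1) A(2), of "e $ j" j] by simp
      thus ?thesis using False by (auto intro!: prod_zero)
    qed
    finally show ?thesis .
  qed
  have "(\<Sum>x\<in>PiE UNIV A. ?w x * eval_mpoly F (vec_lambda x)) =
     (\<Sum>x\<in>PiE UNIV A. \<Sum>e\<in>Poly_Mapping.keys F. Poly_Mapping.lookup F e * (?w x * monomial_value (vec_lambda x) e))"
    by (simp add: eval_mpoly_def sum_distrib_left mult.left_commute)
  also have "\<dots> = (\<Sum>e\<in>Poly_Mapping.keys F. Poly_Mapping.lookup F e * (if e = i then ?D else 0))"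
    by (subst sum.swap) (simp add: sum_distrib_left[symmetric] mono)
  also have "\<dots> = Poly_Mapping.lookup F i * ?D"
    by (simp add: if_distrib cong: if_cong) (simp add: in_keys_iff)
  finally show ?thesis .
qed

text \<open>Modulo \<open>m\<close> the weighted sum vanishes on a grid of zeros, and the coprime
  coefficient cancels. What \<open>m\<close> then divides is a nonzero product of coordinate
  differences, with \<open>i $ j * Suc (i $ j)\<close> factors of size at most \<open>M\<close> from
  coordinate \<open>j\<close>.\<close>

lemma grid_of_zeros_spread:
  fixes F :: "('d::finite) mpoly" and A :: "'d \<Rightarrow> int set"
  assumes deg: "\<And>e. e \<in> Poly_Mapping.keys F \<Longrightarrow> multi_degree e \<le> multi_degree i"
    and cop: "coprime (int m) (Poly_Mapping.lookup F i)"
    and A: "\<And>j. finite (A j)" "\<And>j. card (A j) = Suc (i $ j)"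
    and M: "\<And>j a b. a \<in> A j \<Longrightarrow> b \<in> A j \<Longrightarrow> \<bar>a - b\<bar> \<le> M"
    and zero: "\<And>x. x \<in> Pi UNIV A \<Longrightarrow> [eval_mpoly F (vec_lambda x) = 0] (mod int m)"
  shows "int m \<le> M ^ (\<Sum>j\<in>UNIV. i $ j * Suc (i $ j))"
proof -
  let ?D = "\<Prod>j\<in>UNIV. diff_prod (A j)"
  have "int m dvd (\<Sum>x\<in>PiE UNIV A. (\<Prod>j\<in>UNIV. cofactor (A j) (x j)) * eval_mpoly F (vec_lambda x))"
    using zero by (intro dvd_sum dvd_mult) (auto simp: cong_0_iff PiE_UNIV_domain)
  hence "int m dvd ?D"
    using combinatorial_nullstellensatz_sum[OF deg A] cop by (simp add: coprime_dvd_mult_right_iff)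
  moreover have "?D \<noteq> 0" using A diff_prod_nonzero by simp
  ultimately have "int m \<le> \<bar>?D\<bar>" by (intro zdvd_imp_le) auto
  also have "\<dots> = (\<Prod>j\<in>UNIV. \<bar>diff_prod (A j)\<bar>)" by (simp add: abs_prod)
  also have "\<dots> \<le> (\<Prod>j\<in>UNIV. M ^ (i $ j * Suc (i $ j)))"
    using abs_diff_prod_le[OF A(1) A(2) M] by (intro prod_mono) auto
  also have "\<dots> = M ^ (\<Sum>j\<in>UNIV. i $ j * Suc (i $ j))" by (simp add: power_sum)
  finally show ?thesis .
qed

section \<open>Multi-indices of given degree\<close>

text \<open>Pascal's rule: raising \<open>a\<close> by one adds a binomial coefficient that is at
  least \<open>(s + d) choose d\<close>.\<close>

lemma Suc_mult_binomial_le: "Suc a * ((s + d) choose d) \<le> (s + a + Suc d) choose Suc d"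
proof (induction a)
  case (Suc a)
  have "(s + d) choose d \<le> (s + a + Suc d) choose d" by (intro binomial_right_mono) auto
  thus ?case using Suc by simp
qed simp

text \<open>The left side counts the exponent vectors dominated by \<open>i\<close>, the right side
  those of total degree at most \<open>sum i J\<close>. This bounds the product occurring in the
  exponents by \<open>r + 1\<close>.\<close>

lemma prod_Suc_le_binomial:
  assumes "finite J"
  shows "(\<Prod>j\<in>J. Suc (i j)) \<le> (sum i J + card J) choose card J"
  using assms
proof (induction J rule: finite_induct)
  case (insert j J)
  have "Suc (i j) * (\<Prod>j\<in>J. Suc (i j)) \<le> Suc (i j) * ((sum i J + card J) choose card J)"
    by (intro mult_left_mono insert.IH) auto
  also have "\<dots> \<le> (sum i J + i j + Suc (card J)) choose Suc (card J)" by (rule Suc_mult_binomial_le)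
  finally show ?case using insert.hyps by (simp add: add_ac)
qed simp

lemma finite_multi_degree: "finite {i :: nat ^ 'd::finite. multi_degree i = k}"
proof (rule finite_subset)
  show "{i :: nat ^ 'd. multi_degree i = k} \<subseteq> vec_lambda ` (PiE UNIV (\<lambda>_. {..k}))"
  proof
    fix i :: "nat ^ 'd" assume "i \<in> {i. multi_degree i = k}"
    hence "i $ j \<le> k" for j
      using member_le_sum[of j UNIV "\<lambda>j. i $ j"] by (auto simp: multi_degree_def)
    hence "vec_nth i \<in> PiE UNIV (\<lambda>_. {..k})" by auto
    thus "i \<in> vec_lambda ` (PiE UNIV (\<lambda>_. {..k}))" by (metis imageI vec_nth_inverse)
  qed
  show "finite (vec_lambda ` (PiE UNIV (\<lambda>_::'d. {..k})))" by (intro finite_imageI finite_PiE) auto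
qed

lemma g_coeff_attained:
  fixes F :: "('d::finite) mpoly"
  obtains i where "multi_degree i = total_degree F" "g_coeff m F = gcd (int m) (Poly_Mapping.lookup F i)"
proof -
  let ?I = "{i :: nat ^ 'd. multi_degree i = total_degree F}"
  obtain j :: 'd where "True" by simp
  \<comment> \<open>Putting the whole degree on one coordinate shows that the minimum is taken over
    a nonempty set.\<close>
  have "(\<chi> j'. if j' = j then total_degree F else 0) \<in> ?I" by (simp add: multi_degree_def)
  hence "g_coeff m F \<in> (\<lambda>i. gcd (int m) (Poly_Mapping.lookup F i)) ` ?I"
    unfolding g_coeff_def using finite_multi_degree by (intro Min_in) auto
  thus thesis using that by auto
qed

lemma multi_degree_le_total_degree:
  assumes "e \<in> Poly_Mapping.keys F" shows "multi_degree e \<le> total_degree F"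
  unfolding total_degree_def using assms by (intro Max_ge) auto

section \<open>Covering by cubes\<close>

text \<open>Closed, so that the cells with indices below \<open>T\<close> cover the faces
  \<open>u $ j = 1\<close> too; a point on a shared face is counted more than once, which an upper
  bound tolerates.\<close>

definition cell :: "nat \<Rightarrow> ('d \<Rightarrow> nat) \<Rightarrow> (real ^ 'd) set" where
  "cell T z = {u. \<forall>j. real (z j) / real T \<le> u $ j \<and> u $ j \<le> (real (z j) + 1) / real T}"

lemma measure_cube_cart:
  fixes a :: "real ^ 'd::finite"
  assumes "s \<ge> 0"
  shows "measure lebesgue (box a (a + s *\<^sub>R 1)) = s ^ CARD('d)"
proof -
  have "measure lebesgue (box a (a + s *\<^sub>R 1)) = measure lborel (cbox a (a + s *\<^sub>R 1))"
    by (simp add: measure_lborel_box_eq measure_lborel_cbox_eq)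
  also have "\<dots> = (\<Prod>j\<in>(UNIV :: 'd set). s)"
    using assms by (subst content_cbox_cart) (auto simp: interval_ne_empty_cart)
  finally show ?thesis by simp
qed

lemma unit_cube_cell:
  assumes "u \<in> (unit_cube :: (real ^ 'd::finite) set)" "T \<ge> 1"
  shows "\<exists>z\<in>PiE UNIV (\<lambda>_. {..<T}). u \<in> cell T z"
proof -
  have "\<exists>t<T. real t / real T \<le> u $ j \<and> u $ j \<le> (real t + 1) / real T" for j
  proof (cases "u $ j = 1")
    case True
    \<comment> \<open>The last cell takes the face; rounding down would give the index
      \<open>T\<close>.\<close>
    thus ?thesis using assms by (intro exI[of _ "T - 1"]) (auto simp: field_simps of_nat_diff)
  next
    case False
    have u: "0 \<le> u $ j" "u $ j < 1" using assms False by (auto simp: mem_box_cart order_less_le)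
    define t where "t = nat \<lfloor>real T * u $ j\<rfloor>"
    have "real t \<le> real T * u $ j" "real T * u $ j < real t + 1"
      using u by (auto simp: t_def)
    moreover have "real T * u $ j < real T" using u assms by simp
    ultimately have "t < T" by linarith
    with \<open>real t \<le> real T * u $ j\<close> \<open>real T * u $ j < real t + 1\<close> show ?thesis using assms
      by (intro exI[of _ t]) (auto simp: field_simps)
  qed
  then obtain z where "\<And>j. z j < T \<and> real (z j) / real T \<le> u $ j \<and> u $ j \<le> (real (z j) + 1) / real T"
    by metis
  thus ?thesis by (intro bexI[of _ z]) (auto simp: cell_def)
qed

text \<open>The interiors of the cells meeting \<Omega> are disjoint, have volume
  \<open>(1 / real T) ^ CARD('d)\<close> each, and stay within a cell diameter of \<Omega>, hence in
  \<Omega> or its outer collar. Comparing volumes bounds their number.\<close>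

lemma card_cells_le:
  fixes \<Omega> :: "(real ^ 'd::finite) set"
  assumes ws: "well_shaped C \<Omega>" and meas: "\<Omega> \<in> lmeasurable" and T: "T \<ge> 1"
  shows "real (card {z\<in>PiE UNIV (\<lambda>_. {..<T}). cell T z \<inter> \<Omega> \<noteq> {}})
     \<le> real T ^ CARD('d) * (measure lebesgue \<Omega> + C * (2 * real CARD('d) / real T))"
proof -
  \<comment> \<open>Two points of a cell differ by at most \<open>1 / real T\<close> in each
    coordinate, so by at most \<open>CARD('d) / T\<close> in norm; doubling makes the collar
    inequality strict.\<close>
  define \<epsilon> where "\<epsilon> = 2 * real CARD('d) / real T"
  define Z where "Z = {z\<in>PiE UNIV (\<lambda>_::'d. {..<T}). cell T z \<inter> \<Omega> \<noteq> {}}"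
  define lo :: "('d \<Rightarrow> nat) \<Rightarrow> real ^ 'd" where "lo z = (\<chi> j. real (z j) / real T)" for z
  define b where "b z = box (lo z) (lo z + (1 / real T) *\<^sub>R 1)" for z
  have b: "u \<in> b z \<longleftrightarrow> (\<forall>j. real (z j) / real T < u $ j \<and> u $ j < (real (z j) + 1) / real T)" for u z
    by (simp add: b_def lo_def mem_box_cart add_divide_distrib)
  have \<epsilon>0: "\<epsilon> > 0" using T by (simp add: \<epsilon>_def)
  have fZ: "finite Z" unfolding Z_def by (simp add: finite_PiE)
  have out: "outer_collar \<Omega> \<epsilon> \<in> lmeasurable" "measure lebesgue (outer_collar \<Omega> \<epsilon>) \<le> C * \<epsilon>"
    using ws \<epsilon>0 by (auto simp: well_shaped_def)
  have disj: "disjoint_family_on b Z"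
  proof (unfold disjoint_family_on_def, intro ballI impI)
    fix z z' :: "'d \<Rightarrow> nat" assume "z \<noteq> z'"
    then obtain j where "z j \<noteq> z' j" by blast
    hence "real (z j) + 1 \<le> real (z' j) \<or> real (z' j) + 1 \<le> real (z j)" by linarith
    hence "(real (z j) + 1) / real T \<le> real (z' j) / real T \<or> (real (z' j) + 1) / real T \<le> real (z j) / real T"
      by (auto intro: divide_right_mono)
    thus "b z \<inter> b z' = {}" by (auto simp: set_eq_iff b) (meson order.strict_trans1 order.strict_trans2 order_less_irrefl less_trans not_less)+
  qed
  have sub: "b z \<subseteq> \<Omega> \<union> outer_collar \<Omega> \<epsilon>" if z: "z \<in> Z" for z
  proof
    fix u assume u: "u \<in> b z"
    obtain y where y: "y \<in> cell T z" "y \<in> \<Omega>" using z by (auto simp: Z_def)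
    have ucube: "u \<in> unit_cube"
    proof -
      have "0 \<le> u $ j \<and> u $ j \<le> 1" for j
      proof -
        have "real (z j) / real T < u $ j" "u $ j < (real (z j) + 1) / real T" using u by (auto simp: b)
        moreover have "0 \<le> real (z j) / real T" by simp
        moreover have "z j < T" using z by (auto simp: Z_def)
        hence "(real (z j) + 1) / real T \<le> 1" by (simp add: field_simps)
        ultimately show ?thesis by linarith
      qed
      thus ?thesis by (simp add: mem_box_cart)
    qed
    have "norm (u - y) \<le> (\<Sum>j\<in>UNIV. \<bar>(u - y) $ j\<bar>)" by (rule norm_le_l1_cart)
    also have "\<dots> \<le> (\<Sum>j\<in>(UNIV::'d set). 1 / real T)"
    proof (intro sum_mono)
      fix j
      have "real (z j) / real T < u $ j" "u $ j < real (z j) / real T + 1 / real T"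
        "real (z j) / real T \<le> y $ j" "y $ j \<le> real (z j) / real T + 1 / real T"
        using u y(1) by (auto simp: b cell_def add_divide_distrib)
      thus "\<bar>(u - y) $ j\<bar> \<le> 1 / real T" by simp
    qed
    also have "\<dots> < \<epsilon>" using T by (simp add: \<epsilon>_def field_simps)
    finally have "set_dist u \<Omega> < ereal \<epsilon>" using y(2)
      by (auto simp: set_dist_def INF_less_iff intro!: bexI[of _ y])
    thus "u \<in> \<Omega> \<union> outer_collar \<Omega> \<epsilon>" using ucube by (auto simp: outer_collar_def)
  qed
  have bm: "b z \<in> lmeasurable" for z by (simp add: b_def)
  have "measure lebesgue (\<Union>z\<in>Z. b z) = (\<Sum>z\<in>Z. measure lebesgue (b z))"
    using fZ disj bm fmeasurableD2[OF bm] by (intro measure_finite_Union) auto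
  hence "real (card Z) * (1 / real T) ^ CARD('d) = measure lebesgue (\<Union>z\<in>Z. b z)"
    unfolding b_def by (subst (asm) measure_cube_cart) (auto)
  also have "\<dots> \<le> measure lebesgue (\<Omega> \<union> outer_collar \<Omega> \<epsilon>)"
    using sub meas out fZ by (intro measure_mono_fmeasurable) (auto simp: b_def)
  also have "\<dots> \<le> measure lebesgue \<Omega> + measure lebesgue (outer_collar \<Omega> \<epsilon>)"
    using meas out by (intro measure_Un_le) auto
  also have "\<dots> \<le> measure lebesgue \<Omega> + C * \<epsilon>" using out by simp
  finally show ?thesis using T unfolding Z_def[symmetric] \<epsilon>_def[symmetric]
    by (simp add: power_one_over field_simps)
qed

section \<open>Zeros in a cube and in \<Omega>\<close>

text \<open>A grid of zeros with \<open>Suc (i $ j)\<close> values in coordinate \<open>j\<close>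
  would have spread at most \<open>M\<close>, which \<open>grid_of_zeros_spread\<close> excludes
  under the bound on the power of \<open>M\<close>. So \<open>box_free_bound\<close> applies, with a
  constant independent of \<open>m\<close>, \<open>F\<close>, \<open>a\<close> and
  \<open>M\<close>.\<close>

lemma zeros_in_cube_le:
  fixes i :: "nat ^ 'd::finite" and j0 :: 'd
  shows "\<exists>K>0. \<forall>m (F :: 'd mpoly) (a :: 'd \<Rightarrow> real) M. total_degree F = multi_degree i \<longrightarrow>
    coprime (int m) (Poly_Mapping.lookup F i) \<longrightarrow> 0 \<le> M \<longrightarrow>
    M ^ (\<Sum>j\<in>UNIV. i $ j * Suc (i $ j)) < real m \<longrightarrow>
    real (card {x :: int ^ 'd. [eval_mpoly F x = 0] (mod int m) \<and> (\<forall>j. a j \<le> real_of_int (x $ j) \<and> real_of_int (x $ j) \<le> a j + M)})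
      \<le> K * (real (nat \<lfloor>M\<rfloor> + 1)) ^ CARD('d) * (real (nat \<lfloor>M\<rfloor> + 1)) powr (- 1 / real (\<Prod>j\<in>-{j0}. Suc (i $ j)))"
proof -
  obtain K where K: "K > 0" and main: "\<forall>n (X :: 'd \<Rightarrow> int set) S. n \<ge> 1 \<longrightarrow> (\<forall>j. finite (X j) \<and> card (X j) = n) \<longrightarrow>
     S \<subseteq> Pi UNIV X \<longrightarrow> \<not> (\<exists>B. (\<forall>j. B j \<subseteq> X j \<and> card (B j) = Suc (i $ j)) \<and> Pi UNIV B \<subseteq> S) \<longrightarrow>
     real (card S) \<le> K * real n ^ CARD('d) * real n powr (- 1 / real (\<Prod>j\<in>-{j0}. Suc (i $ j)))"
    using box_free_bound[of "\<lambda>j. Suc (i $ j)" j0, where ?'b=int] by auto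
  show ?thesis
  proof (rule exI[of _ K], intro conjI allI impI)
    fix m and F :: "'d mpoly" and a :: "'d \<Rightarrow> real" and M :: real
    assume deg: "total_degree F = multi_degree i" and cop: "coprime (int m) (Poly_Mapping.lookup F i)"
      and M: "0 \<le> M" "M ^ (\<Sum>j\<in>UNIV. i $ j * Suc (i $ j)) < real m"
    \<comment> \<open>Sides of the common size required by \<open>box_free_bound\<close>:
      \<open>nat \<lfloor>M\<rfloor> + 1\<close> consecutive integers, among them every integer
      between \<open>a j\<close> and \<open>a j + M\<close>.\<close>
    define X where "X j = {\<lceil>a j\<rceil>..\<lceil>a j\<rceil> + \<lfloor>M\<rfloor>}" for j :: 'd
    define S0 where "S0 = {x :: int ^ 'd. [eval_mpoly F x = 0] (mod int m) \<and> (\<forall>j. a j \<le> real_of_int (x $ j) \<and> real_of_int (x $ j) \<le> a j + M)}"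
    have "real (card (vec_nth ` S0)) \<le> K * (real (nat \<lfloor>M\<rfloor> + 1)) ^ CARD('d) * (real (nat \<lfloor>M\<rfloor> + 1)) powr (- 1 / real (\<Prod>j\<in>-{j0}. Suc (i $ j)))"
    proof (rule main[rule_format])
      show "1 \<le> nat \<lfloor>M\<rfloor> + 1" by simp
      show "finite (X j) \<and> card (X j) = nat \<lfloor>M\<rfloor> + 1" for j using M by (simp add: X_def nat_add_distrib)
      show "vec_nth ` S0 \<subseteq> Pi UNIV X"
      proof (rule image_subsetI, rule Pi_I)
        fix x j assume "x \<in> S0"
        hence x: "a j \<le> real_of_int (x $ j)" "real_of_int (x $ j) \<le> a j + M" by (auto simp: S0_def)
        have "\<lceil>a j\<rceil> \<le> x $ j" using x by (simp add: ceiling_le_iff)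
        moreover have "real_of_int (x $ j - \<lceil>a j\<rceil>) \<le> M" using x by linarith
        hence "x $ j - \<lceil>a j\<rceil> \<le> \<lfloor>M\<rfloor>" by (simp only: le_floor_iff)
        ultimately show "x $ j \<in> X j" by (simp add: X_def)
      qed
      show "\<not> (\<exists>B. (\<forall>j. B j \<subseteq> X j \<and> card (B j) = Suc (i $ j)) \<and> Pi UNIV B \<subseteq> vec_nth ` S0)"
      proof
        assume "\<exists>B. (\<forall>j. B j \<subseteq> X j \<and> card (B j) = Suc (i $ j)) \<and> Pi UNIV B \<subseteq> vec_nth ` S0"
        then obtain B where B: "\<And>j. B j \<subseteq> X j" "\<And>j. card (B j) = Suc (i $ j)" "Pi UNIV B \<subseteq> vec_nth ` S0" by blast
        have "int m \<le> \<lfloor>M\<rfloor> ^ (\<Sum>j\<in>UNIV. i $ j * Suc (i $ j))"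
        proof (rule grid_of_zeros_spread)
          show "multi_degree e \<le> multi_degree i" if "e \<in> Poly_Mapping.keys F" for e
            using multi_degree_le_total_degree[OF that] deg by simp
          show "finite (B j)" for j using B(1)[of j] by (rule finite_subset) (simp add: X_def)
          show "\<bar>x - y\<bar> \<le> \<lfloor>M\<rfloor>" if "x \<in> B j" "y \<in> B j" for x y j
          proof -
            have "x \<in> X j" "y \<in> X j" using B(1)[of j] that by auto
            thus ?thesis by (auto simp: X_def)
          qed
          show "[eval_mpoly F (vec_lambda x) = 0] (mod int m)" if x: "x \<in> Pi UNIV B" for x
          proof -
            obtain y where "y \<in> S0" "x = vec_nth y" using B(3) x by blast
            thus ?thesis by (simp add: S0_def vec_lambda_eta)
          qed
        qed (use B cop in auto)
        hence "real m \<le> real_of_int \<lfloor>M\<rfloor> ^ (\<Sum>j\<in>UNIV. i $ j * Suc (i $ j))"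
          by (metis of_int_le_iff of_int_of_nat_eq of_int_power)
        also have "\<dots> \<le> M ^ (\<Sum>j\<in>UNIV. i $ j * Suc (i $ j))" using M by (intro power_mono) auto
        finally show False using M by simp
      qed
    qed
    also have "card (vec_nth ` S0) = card S0" by (intro card_image) (simp add: inj_on_def vec_eq_iff)
    finally show "real (card S0) \<le> K * (real (nat \<lfloor>M\<rfloor> + 1)) ^ CARD('d) * (real (nat \<lfloor>M\<rfloor> + 1)) powr (- 1 / real (\<Prod>j\<in>-{j0}. Suc (i $ j)))" .
  qed (rule K)
qed

text \<open>Up to constants, at most \<open>T ^ d * \<mu>\<close> cells meet \<Omega>, and after
  scaling by \<open>m\<close> each holds at most \<open>n powr (d - 1 / Q)\<close> zeros, where
  \<open>T * n\<close> has order \<open>m\<close>. Here \<open>n\<close> has order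
  \<open>min (m * \<mu>) (m powr (1 / E))\<close>, and the two cases give the two terms. Both bases
  are at least 1, so the exponents may be weakened to \<kappa> and \<alpha>.\<close>

lemma N_sol_le:
  fixes i :: "nat ^ 'd::finite" and j0 :: 'd and C \<alpha> :: real
  defines "Q \<equiv> real (\<Prod>j\<in>-{j0}. Suc (i $ j))"
    and "E \<equiv> \<Sum>j\<in>UNIV. i $ j * Suc (i $ j)"
  assumes E: "E \<ge> 1" and \<alpha>: "0 \<le> \<alpha>" "\<alpha> \<le> 1 / (real E * Q)"
    and \<kappa>: "0 \<le> \<kappa>" "\<kappa> \<le> 1 / Q"
  shows "\<exists>K>0. \<forall>m (F :: 'd mpoly) \<Omega>. m \<ge> 1 \<longrightarrow> total_degree F = multi_degree i \<longrightarrow>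
    coprime (int m) (Poly_Mapping.lookup F i) \<longrightarrow> well_shaped C \<Omega> \<longrightarrow> measure lebesgue \<Omega> \<ge> 1 / real m \<longrightarrow>
    real (N_sol m F \<Omega>) \<le> K * (real m ^ CARD('d) * measure lebesgue \<Omega> *
      ((real m * measure lebesgue \<Omega>) powr (- \<kappa>) + real m powr (- \<alpha>)))"
proof -
  let ?d = "CARD('d)"
  have "(\<Prod>j\<in>-{j0}. Suc (i $ j)) \<ge> 1" by (intro prod_ge_1) auto
  hence Q: "Q \<ge> 1" unfolding Q_def by linarith
  obtain K where K: "K > 0" and cell: "\<forall>m (F :: 'd mpoly) (a :: 'd \<Rightarrow> real) M. total_degree F = multi_degree i \<longrightarrow>
    coprime (int m) (Poly_Mapping.lookup F i) \<longrightarrow> 0 \<le> M \<longrightarrow> M ^ E < real m \<longrightarrow>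
    real (card {x :: int ^ 'd. [eval_mpoly F x = 0] (mod int m) \<and> (\<forall>j. a j \<le> real_of_int (x $ j) \<and> real_of_int (x $ j) \<le> a j + M)})
      \<le> K * (real (nat \<lfloor>M\<rfloor> + 1)) ^ CARD('d) * (real (nat \<lfloor>M\<rfloor> + 1)) powr (- 1 / Q)"
    using zeros_in_cube_le[of i j0] unfolding Q_def E_def by (elim exE conjE)
  \<comment> \<open>The factor 2 comes from \<open>nQ\<close>, \<open>3 ^ ?d\<close> from
    \<open>n \<le> 3 * M\<close>, and the last factor from the number of cells, with the collar term
    absorbed into \<mu>.\<close>
  define K' where "K' = 2 * K * 3 ^ ?d * (1 + 2 * real ?d * \<bar>C\<bar>)"
  show ?thesis
  proof (rule exI[of _ K'], intro conjI allI impI)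
    show "K' > 0" unfolding K'_def using K by (intro mult_pos_pos add_pos_nonneg) auto
    fix m and F :: "'d mpoly" and \<Omega> :: "(real ^ 'd) set"
    assume m1: "m \<ge> 1" and deg: "total_degree F = multi_degree i"
      and cop: "coprime (int m) (Poly_Mapping.lookup F i)" and ws: "well_shaped C \<Omega>"
      and \<mu>m: "measure lebesgue \<Omega> \<ge> 1 / real m"
    define \<mu> where "\<mu> = measure lebesgue \<Omega>"
    have \<mu>0: "\<mu> > 0" and m\<mu>: "real m * \<mu> \<ge> 1" using \<mu>m m1 unfolding \<mu>_def[symmetric]
      by (auto simp: field_simps intro: less_le_trans[of 0 "1 / real m"])
    have cube: "(unit_cube :: (real ^ 'd) set) \<in> lmeasurable" "measure lebesgue (unit_cube :: (real ^ 'd) set) = 1"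
      by (simp_all add: content_cbox_cart interval_ne_empty_cart)
    have sub: "\<Omega> \<subseteq> unit_cube" using ws by (simp add: well_shaped_def)
    \<comment> \<open>\<open>measure\<close> is 0 on nonmeasurable sets, so positivity forces
      measurability.\<close>
    have "\<Omega> \<in> sets lebesgue" using \<mu>0 measure_notin_sets[of \<Omega> lebesgue] by (auto simp: \<mu>_def)
    hence meas: "\<Omega> \<in> lmeasurable" using sub cube by (meson fmeasurableI2)
    have \<mu>1: "\<mu> \<le> 1" unfolding \<mu>_def
      using measure_mono_fmeasurable[OF sub _ cube(1)] meas cube by auto

    \<comment> \<open>\<open>1 / T \<le> \<mu>\<close> makes the collar negligible, and \<open>T > m powr (1 - 1 / E)\<close> makes
      \<open>zeros_in_cube_le\<close> applicable to cells of side \<open>M\<close>.\<close>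
    define w where "w = max (1 / \<mu>) (real m powr (1 - 1 / real E))"
    define T where "T = nat \<lfloor>w\<rfloor> + 1"
    define M where "M = real m / real T"
    define n where "n = nat \<lfloor>M\<rfloor> + 1"
    have w1: "w \<ge> 1" using \<mu>0 \<mu>1 by (simp add: w_def le_max_iff_disj)
    have T: "w < real T" "real T \<le> 2 * w" "T \<ge> 1" using w1 by (auto simp: T_def; linarith)+
    have M0: "M > 0" using m1 T by (simp add: M_def)
    have "M < real m powr (1 / real E)"
    proof -
      have "real m powr (1 - 1 / real E) < real T" using T(1) by (simp add: w_def)
      hence "real m / real T < real m / real m powr (1 - 1 / real E)"
        using m1 T by (intro divide_strict_left_mono mult_pos_pos) auto
      also have "\<dots> = real m powr (1 / real E)" using m1 by (simp add: powr_diff)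
      finally show ?thesis by (simp add: M_def)
    qed
    hence "M ^ E < (real m powr (1 / real E)) ^ E" using M0 E by (intro power_strict_mono) auto
    hence ME: "M ^ E < real m" using E m1 by (simp add: powr_power)
    have wm: "w / real m = max (1 / (real m * \<mu>)) (real m powr (- 1 / real E))"
      using m1 \<mu>0 by (simp add: w_def max_divide_distrib_right powr_diff powr_minus field_simps)
    have wm1: "w / real m \<le> 1" unfolding wm using m1 m\<mu> powr_mono[of "- 1 / real E" 0 "real m"] by simp
    have M2: "real m / (2 * w) \<le> M" unfolding M_def using T m1 by (intro divide_left_mono) auto
    \<comment> \<open>This gives \<open>n \<le> M + 1 \<le> 3 * M\<close>, so rounding costs only a
      constant even if a scaled cell has side below 1.\<close>
    have M12: "1 / 2 \<le> M"
    proof -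
      have "w \<le> real m" using wm1 m1 by simp
      hence "1 / 2 \<le> real m / (2 * w)" using w1 by (simp add: field_simps)
      thus ?thesis using M2 by simp
    qed
    have n: "M \<le> real n" "real n \<le> 3 * M" using M12 by (auto simp: n_def; linarith)+
    \<comment> \<open>\<open>1 / n\<close> is at most \<open>2 * (w / m)\<close>, twice a maximum of
      two quantities; a power of the maximum is one of the two powers, hence at most their
      sum.\<close>
    have nQ: "real n powr (- 1 / Q) \<le> 2 * ((real m * \<mu>) powr (- \<kappa>) + real m powr (- \<alpha>))"
    proof -
      have "real n powr (- 1 / Q) \<le> (real m / (2 * w)) powr (- 1 / Q)"
        using n M2 w1 m1 Q by (intro powr_mono2') auto
      also have "\<dots> = (2 * (w / real m)) powr (1 / Q)"
        using w1 m1 by (simp add: powr_minus powr_divide powr_mult field_simps)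
      also have "\<dots> = 2 powr (1 / Q) * (w / real m) powr (1 / Q)"
        by (rule powr_mult)
      also have "\<dots> \<le> 2 powr 1 * (w / real m) powr (1 / Q)"
        using Q by (intro mult_right_mono powr_mono) auto
      also have "(w / real m) powr (1 / Q) \<le> (real m * \<mu>) powr (- \<kappa>) + real m powr (- \<alpha>)"
      proof -
        have 1: "(1 / (real m * \<mu>)) powr (1 / Q) \<le> (real m * \<mu>) powr (- \<kappa>)"
        proof -
          have "(1 / (real m * \<mu>)) powr (1 / Q) = (real m * \<mu>) powr (- (1 / Q))"
            using m\<mu> by (simp only: powr_minus_divide powr_divide powr_one_eq_one)
          also have "\<dots> \<le> (real m * \<mu>) powr (- \<kappa>)" using m\<mu> \<kappa> by (intro powr_mono) auto
          finally show ?thesis .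
        qed
        have 2: "(real m powr (- 1 / real E)) powr (1 / Q) \<le> real m powr (- \<alpha>)"
          unfolding powr_powr using \<alpha> m1 by (intro powr_mono) auto
        have "w / real m = 1 / (real m * \<mu>) \<or> w / real m = real m powr (- 1 / real E)"
          unfolding wm by linarith
        thus ?thesis using 1 2 by (smt (verit) powr_ge_zero)
      qed
      finally show ?thesis by simp
    qed

    define Z where "Z = {z\<in>PiE UNIV (\<lambda>_::'d. {..<T}). cell T z \<inter> \<Omega> \<noteq> {}}"
    \<comment> \<open>The zeros in cell \<open>z\<close> scaled by \<open>m\<close>, which turns the
      side \<open>1 / T\<close> into \<open>M\<close>.\<close>
    define S where "S z = {x :: int ^ 'd. [eval_mpoly F x = 0] (mod int m) \<and>
       (\<forall>j. real (z j) * M \<le> real_of_int (x $ j) \<and> real_of_int (x $ j) \<le> real (z j) * M + M)}" for z :: "'d \<Rightarrow> nat"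
    have fZ: "finite Z" unfolding Z_def by (simp add: finite_PiE)
    have fS: "finite (S z)" for z
    proof (rule finite_subset)
      show "S z \<subseteq> vec_lambda ` (PiE UNIV (\<lambda>j. {\<lceil>real (z j) * M\<rceil>..\<lfloor>real (z j) * M + M\<rfloor>}))"
      proof
        fix x assume "x \<in> S z"
        hence "vec_nth x \<in> PiE UNIV (\<lambda>j. {\<lceil>real (z j) * M\<rceil>..\<lfloor>real (z j) * M + M\<rfloor>})"
          by (auto simp: S_def ceiling_le_iff le_floor_iff)
        thus "x \<in> vec_lambda ` (PiE UNIV (\<lambda>j. {\<lceil>real (z j) * M\<rceil>..\<lfloor>real (z j) * M + M\<rfloor>}))"
          by (rule rev_image_eqI) (simp add: vec_lambda_eta)
      qed
    qed (intro finite_imageI finite_PiE; auto)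
    define B where "B = K * real n ^ ?d * real n powr (- 1 / Q)"
    have cS: "real (card (S z)) \<le> B" for z
      using cell[rule_format, OF deg cop less_imp_le[OF M0] ME, of "\<lambda>j. real (z j) * M"]
      by (simp only: S_def n_def B_def)
    have "N_sol m F \<Omega> \<le> card (\<Union>z\<in>Z. S z)"
      unfolding N_sol_def
    proof (rule card_mono)
      show "finite (\<Union>z\<in>Z. S z)" using fZ fS by simp
      show "{x. [eval_mpoly F x = 0] (mod int m) \<and> (\<chi> j. real_of_int (x $ j) / real m) \<in> \<Omega>} \<subseteq> (\<Union>z\<in>Z. S z)"
      proof clarify
        fix x :: "int ^ 'd"
        let ?u = "\<chi> j. real_of_int (x $ j) / real m"
        assume x: "[eval_mpoly F x = 0] (mod int m)" "?u \<in> \<Omega>"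
        obtain z where z: "z \<in> PiE UNIV (\<lambda>_. {..<T})" "?u \<in> cell T z"
          using unit_cube_cell[of ?u T] sub x(2) T(3) by blast
        have "x \<in> S z" using x z(2) m1 T(3) unfolding S_def cell_def M_def
          by (auto simp: field_simps)
        moreover have "z \<in> Z" using z x by (auto simp: Z_def)
        ultimately show "x \<in> (\<Union>z\<in>Z. S z)" by blast
      qed
    qed
    also have "\<dots> \<le> (\<Sum>z\<in>Z. card (S z))" by (rule card_UN_le[OF fZ])
    finally have "real (N_sol m F \<Omega>) \<le> (\<Sum>z\<in>Z. real (card (S z)))" by (metis of_nat_le_iff of_nat_sum)
    also have "\<dots> \<le> (\<Sum>z\<in>Z. B)" by (intro sum_mono cS)
    also have "\<dots> = real (card Z) * B" by simp
    also have "\<dots> \<le> (real T ^ ?d * (\<mu> * (1 + 2 * real ?d * \<bar>C\<bar>))) * B"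
    proof (rule mult_right_mono)
      have "real (card Z) \<le> real T ^ ?d * (\<mu> + C * (2 * real ?d / real T))"
        using card_cells_le[OF ws meas T(3)] by (simp only: Z_def \<mu>_def)
      also have "\<dots> \<le> real T ^ ?d * (\<mu> * (1 + 2 * real ?d * \<bar>C\<bar>))"
      proof (rule mult_left_mono)
        have "1 / \<mu> \<le> real T" using T(1) by (simp add: w_def)
        hence "1 / real T \<le> \<mu>" using \<mu>0 T(3) by (simp add: field_simps)
        hence "(2 * real ?d * \<bar>C\<bar>) * (1 / real T) \<le> (2 * real ?d * \<bar>C\<bar>) * \<mu>" by (intro mult_left_mono) auto
        moreover have "C * (2 * real ?d / real T) \<le> \<bar>C\<bar> * (2 * real ?d / real T)" by (intro mult_right_mono) auto
        ultimately show "\<mu> + C * (2 * real ?d / real T) \<le> \<mu> * (1 + 2 * real ?d * \<bar>C\<bar>)"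
          by (simp add: algebra_simps)
      qed auto
      finally show "real (card Z) \<le> real T ^ ?d * (\<mu> * (1 + 2 * real ?d * \<bar>C\<bar>))" .
      show "0 \<le> B" using K by (simp add: B_def)
    qed
    also have "\<dots> \<le> (real T ^ ?d * (\<mu> * (1 + 2 * real ?d * \<bar>C\<bar>))) *
       (K * (3 * M) ^ ?d * (2 * ((real m * \<mu>) powr (- \<kappa>) + real m powr (- \<alpha>))))"
      unfolding B_def using K n nQ \<mu>0 M0
      by (intro mult_left_mono mult_mono power_mono) auto
    also have "\<dots> = K' * ((real T * M) ^ ?d * \<mu> * ((real m * \<mu>) powr (- \<kappa>) + real m powr (- \<alpha>)))"
      by (simp add: K'_def power_mult_distrib algebra_simps)
    also have "real T * M = real m" using T(3) by (simp add: M_def)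
    finally show "real (N_sol m F \<Omega>) \<le> K' * (real m ^ CARD('d) * measure lebesgue \<Omega> *
      ((real m * measure lebesgue \<Omega>) powr (- \<kappa>) + real m powr (- \<alpha>)))" unfolding \<mu>_def .
  qed
qed

section \<open>Exponents and conclusion\<close>

text \<open>Choosing \<open>j0\<close> with the largest entry gives
  \<open>E \<le> k * Suc (i $ j0)\<close>, and the factor \<open>Suc (i $ j0)\<close> completes
  \<open>Q\<close> to the full product \<open>P\<close>, so \<open>E * Q \<le> k * P\<close>. The
  binomial bound gives \<open>P - 1 \<le> r\<close>, and both exponent claims reduce to
  \<open>k * P \<le> 2 * r * (k + 1)\<close>.\<close>

lemma exponent_bounds:
  fixes i :: "nat ^ 'd::finite" and j0 :: 'd
  assumes k: "multi_degree i = k" "k \<ge> 2" and j0: "\<And>j. i $ j \<le> i $ j0"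
  defines "Q \<equiv> real (\<Prod>j\<in>-{j0}. Suc (i $ j))"
    and "E \<equiv> \<Sum>j\<in>UNIV. i $ j * Suc (i $ j)"
    and "r \<equiv> real ((k + CARD('d)) choose CARD('d)) - 1"
  shows "r \<ge> 1" "E \<ge> 1" "1 / (2 * r * (real k + 1)) \<le> 1 / (real E * Q)"
    "real k / (2 * r * (real k + 1)) \<le> 1 / Q"
proof -
  define P where "P = (\<Prod>j\<in>UNIV. Suc (i $ j))"
  have k_sum: "(\<Sum>j\<in>UNIV. i $ j) = k" using k by (simp add: multi_degree_def)
  have PQ: "real P = real (Suc (i $ j0)) * Q"
  proof -
    have "P = Suc (i $ j0) * (\<Prod>j\<in>-{j0}. Suc (i $ j))"
      unfolding P_def by (subst prod.remove[of _ j0]) (simp_all add: Compl_eq_Diff_UNIV)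
    thus ?thesis unfolding Q_def by (simp only: of_nat_mult)
  qed
  have "(\<Prod>j\<in>-{j0}. Suc (i $ j)) \<ge> 1" by (intro prod_ge_1) auto
  hence Q1: "Q \<ge> 1" unfolding Q_def by linarith
  have "i $ j0 \<noteq> 0"
  proof
    assume "i $ j0 = 0"
    hence "i $ j = 0" for j using j0[of j] by simp
    thus False using k_sum k by simp
  qed
  hence P2: "real P \<ge> 2" unfolding PQ using mult_mono[of 2 "real (Suc (i $ j0))" 1 Q] Q1 by simp
  have "P \<le> (k + CARD('d)) choose CARD('d)"
    using prod_Suc_le_binomial[of "UNIV :: 'd set" "\<lambda>j. i $ j"] by (simp add: P_def k_sum)
  hence rP: "r \<ge> real P - 1" unfolding r_def by simp
  show r1: "r \<ge> 1" using rP P2 by simp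
  have kE: "k \<le> E" unfolding E_def k_sum[symmetric] by (intro sum_mono) simp
  thus E1: "E \<ge> 1" using k by simp
  have "E \<le> (\<Sum>j\<in>UNIV. i $ j * Suc (i $ j0))" unfolding E_def by (intro sum_mono mult_left_mono) (auto simp: j0)
  also have "\<dots> = k * Suc (i $ j0)" by (simp only: sum_distrib_right[symmetric] k_sum)
  finally have "real E \<le> real k * real (Suc (i $ j0))" by (metis of_nat_le_iff of_nat_mult)
  hence EQ: "real E * Q \<le> real k * real P" using Q1 unfolding PQ by (simp add: mult_right_mono mult.assoc[symmetric])
  \<comment> \<open>From \<open>P \<ge> 2\<close> follows \<open>P \<le> 2 * (P - 1)\<close>; this
    is where the 2 in the exponents is spent.\<close>
  have "real k * real P \<le> 2 * (real P - 1) * (real k + 1)"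
    using mult_right_mono[OF P2, of "real k"] P2 by (simp add: algebra_simps)
  also have "\<dots> \<le> 2 * r * (real k + 1)" using rP by (intro mult_right_mono) auto
  finally have kP: "real k * real P \<le> 2 * r * (real k + 1)" .
  show "1 / (2 * r * (real k + 1)) \<le> 1 / (real E * Q)"
    using EQ kP E1 Q1 r1 by (intro divide_left_mono mult_pos_pos) auto
  have "Q \<le> real P" unfolding PQ using Q1 by simp
  hence "real k * Q \<le> 2 * r * (real k + 1)" using kP mult_left_mono[of Q "real P" "real k"] by simp
  thus "real k / (2 * r * (real k + 1)) \<le> 1 / Q"
    using Q1 r1 by (simp add: divide_simps)
qed

theorem theorem3p4:
  fixes k :: nat and C \<epsilon> r :: real
  assumes "k \<ge> 2" and "\<epsilon> > 0"
    and "r = real ((k + CARD('d::finite)) choose CARD('d)) - 1"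
  shows "\<exists>m0::nat. \<forall>m::nat. m \<ge> m0 \<longrightarrow> m > 2 \<longrightarrow>
    (\<forall>(F :: 'd mpoly) (\<Omega> :: (real ^ 'd) set).
       F \<in> polys_mod m \<longrightarrow> total_degree F = k \<longrightarrow> g_coeff m F = 1 \<longrightarrow>
       well_shaped C \<Omega> \<longrightarrow> measure lebesgue \<Omega> \<ge> 1 / real m \<longrightarrow>
       (\<exists>\<delta>1 \<delta>2 :: real. \<bar>\<delta>1\<bar> \<le> \<epsilon> \<and> \<bar>\<delta>2\<bar> \<le> \<epsilon> \<and>
          real (N_sol m F \<Omega>) \<le>
            real m powr (real CARD('d) - real k / (2 * r * (real k + 1)) + \<delta>1)
              * measure lebesgue \<Omega> powr (1 - real k / (2 * r * (real k + 1)))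
          + real m powr (real CARD('d) - 1 / (2 * r * (real k + 1)) + \<delta>2)
              * measure lebesgue \<Omega>))"
proof -
  define \<alpha> where "\<alpha> = 1 / (2 * r * (real k + 1))"
  define \<kappa> where "\<kappa> = real k / (2 * r * (real k + 1))"
  let ?I = "{i :: nat ^ 'd. multi_degree i = k}"
  define bd where "bd K i \<longleftrightarrow> (\<forall>m (F :: 'd mpoly) \<Omega>. m \<ge> 1 \<longrightarrow> total_degree F = multi_degree i \<longrightarrow>
    coprime (int m) (Poly_Mapping.lookup F i) \<longrightarrow> well_shaped C \<Omega> \<longrightarrow> measure lebesgue \<Omega> \<ge> 1 / real m \<longrightarrow>
    real (N_sol m F \<Omega>) \<le> K * (real m ^ CARD('d) * measure lebesgue \<Omega> *
      ((real m * measure lebesgue \<Omega>) powr (- \<kappa>) + real m powr (- \<alpha>))))" for K i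
  have "\<forall>i\<in>?I. \<exists>K. K > 0 \<and> bd K i"
  proof
    fix i :: "nat ^ 'd" assume "i \<in> ?I"
    hence i: "multi_degree i = k" by simp
    have "Max (range (vec_nth i)) \<in> range (vec_nth i)" by (intro Max_in) auto
    then obtain j0 where "Max (range (vec_nth i)) = i $ j0" by blast
    hence j0: "i $ j \<le> i $ j0" for j by (metis Max_ge finite finite_imageI rangeI)
    note b = exponent_bounds[OF i assms(1) j0, folded assms(3)]
    show "\<exists>K. K > 0 \<and> bd K i" unfolding bd_def
      by (rule N_sol_le[of i \<alpha> j0 \<kappa> C]) (use b in \<open>auto simp: \<alpha>_def \<kappa>_def\<close>)
  qed
  then obtain K where "\<forall>i\<in>?I. K i > 0 \<and> bd (K i) i" by (rule bchoice[THEN exE])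
  hence K: "\<And>i. i \<in> ?I \<Longrightarrow> K i > 0" and main: "\<And>i. i \<in> ?I \<Longrightarrow> bd (K i) i" by auto
  \<comment> \<open>The constant of \<open>N_sol_le\<close> depends on the multi-index, and which
    one has a coprime coefficient varies with \<open>F\<close> and \<open>m\<close>. The sum over
    the finitely many candidates dominates all these constants at once.\<close>
  define K0 where "K0 = 1 + sum K ?I"
  have K0: "K i \<le> K0" if "i \<in> ?I" for i
  proof -
    have "K i \<le> sum K ?I" using K finite_multi_degree that by (intro member_le_sum) (auto intro: less_imp_le)
    thus ?thesis by (simp add: K0_def)
  qed
  have K0pos: "K0 > 0" unfolding K0_def using K by (intro add_pos_nonneg sum_nonneg less_imp_le) auto
  show ?thesis
  \<comment> \<open>From this \<open>m\<close> on, \<open>m powr \<epsilon> \<ge> K0\<close>, so the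
    constant is absorbed by taking \<open>\<delta>1 = \<delta>2 = \<epsilon>\<close>.\<close>
  proof (rule exI[of _ "nat \<lceil>K0 powr (1 / \<epsilon>)\<rceil>"], intro allI impI)
    fix m and F :: "'d mpoly" and \<Omega> :: "(real ^ 'd) set"
    assume m: "nat \<lceil>K0 powr (1 / \<epsilon>)\<rceil> \<le> m" "2 < m" and deg: "total_degree F = k" and g: "g_coeff m F = 1"
      and ws: "well_shaped C \<Omega>" and \<mu>m: "1 / real m \<le> measure lebesgue \<Omega>"
    define \<mu> where "\<mu> = measure lebesgue \<Omega>"
    have \<mu>0: "\<mu> > 0" using \<mu>m m by (auto simp: \<mu>_def intro: less_le_trans[of 0 "1 / real m"])
    obtain i where i: "multi_degree i = total_degree F" "g_coeff m F = gcd (int m) (Poly_Mapping.lookup F i)"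
      by (rule g_coeff_attained)
    have iI: "i \<in> ?I" using i deg by simp
    have "K0 powr (1 / \<epsilon>) \<le> real m" using m by linarith
    hence "(K0 powr (1 / \<epsilon>)) powr \<epsilon> \<le> real m powr \<epsilon>" using assms(2) by (intro powr_mono2) auto
    hence K0m: "K0 \<le> real m powr \<epsilon>" using assms(2) K0pos by (simp add: powr_powr)
    have nn: "0 \<le> real m ^ CARD('d) * \<mu> * ((real m * \<mu>) powr (- \<kappa>) + real m powr (- \<alpha>))"
      using \<mu>0 by simp
    have "real (N_sol m F \<Omega>) \<le> K i * (real m ^ CARD('d) * \<mu> * ((real m * \<mu>) powr (- \<kappa>) + real m powr (- \<alpha>)))"
      unfolding \<mu>_def using main[OF iI, unfolded bd_def, rule_format, of m F \<Omega>] m i g ws \<mu>m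
      by (simp add: coprime_iff_gcd_eq_1)
    also have "\<dots> \<le> real m powr \<epsilon> * (real m ^ CARD('d) * \<mu> * ((real m * \<mu>) powr (- \<kappa>) + real m powr (- \<alpha>)))"
      using K0[OF iI] K0m nn by (intro mult_right_mono) auto
    also have "\<dots> = real m powr (real CARD('d) - \<kappa> + \<epsilon>) * \<mu> powr (1 - \<kappa>)
        + real m powr (real CARD('d) - \<alpha> + \<epsilon>) * \<mu>"
    proof -
      have "\<mu> powr (1 - \<kappa>) = \<mu> * \<mu> powr (- \<kappa>)"
        using \<mu>0 by (simp add: powr_diff powr_minus_divide)
      moreover have "real m powr (real CARD('d) - x + \<epsilon>) = real m powr \<epsilon> * real m ^ CARD('d) * real m powr (- x)" for x
        using m by (simp add: powr_add powr_diff powr_realpow powr_minus_divide)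
      moreover have "(real m * \<mu>) powr (- \<kappa>) = real m powr (- \<kappa>) * \<mu> powr (- \<kappa>)"
        by (rule powr_mult)
      ultimately show ?thesis by (simp only: algebra_simps)
    qed
    finally show "\<exists>\<delta>1 \<delta>2 :: real. \<bar>\<delta>1\<bar> \<le> \<epsilon> \<and> \<bar>\<delta>2\<bar> \<le> \<epsilon> \<and>
          real (N_sol m F \<Omega>) \<le>
            real m powr (real CARD('d) - real k / (2 * r * (real k + 1)) + \<delta>1)
              * measure lebesgue \<Omega> powr (1 - real k / (2 * r * (real k + 1)))
          + real m powr (real CARD('d) - 1 / (2 * r * (real k + 1)) + \<delta>2)
              * measure lebesgue \<Omega>"
      using assms(2) unfolding \<mu>_def \<kappa>_def \<alpha>_def
      by (intro exI[of _ \<epsilon>]) auto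
  qed
qed

end
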